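(* For every positive integer $k$, every finite graph $G$ and every set $A\subseteq V(G)$, the graph $G$ either contains $k$ pairwise vertex-disjoint even $A$-paths, or there is a vertex set $X\subseteq V(G)$ with $|X|\leq 10k$ that meets every even $A$-path in $G$.
   Context: For a vertex set $A$, an $A$-path is a path with at least one edge whose two endvertices lie in $A$ and none of whose interior vertices lie in $A$. An even $A$-path is an $A$-path whose length (number of edges) is even. *)

theory Defs
  imports Main
begin

definition finite_graph :: "'a set \<Rightarrow> ('a \<Rightarrow> 'a \<Rightarrow> bool) \<Rightarrow> bool" where
  "finite_graph V E \<longleftrightarrow> finite V \<and> (\<forall>u v. E u v \<longrightarrow> u \<in> V \<and> v \<in> V)
     \<and> (\<forall>u v. E u v \<longrightarrow> E v u) \<and> (\<forall>v. \<not> E v v)"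

text \<open>A path in G, given by its list of vertices v0,...,vn (distinct, consecutive ones adjacent).
Its length (number of edges) is length p - 1.\<close>
definition is_path :: "'a set \<Rightarrow> ('a \<Rightarrow> 'a \<Rightarrow> bool) \<Rightarrow> 'a list \<Rightarrow> bool" where
  "is_path V E p \<longleftrightarrow> p \<noteq> [] \<and> distinct p \<and> set p \<subseteq> V
     \<and> (\<forall>i. Suc i < length p \<longrightarrow> E (p ! i) (p ! Suc i))"

definition is_A_path :: "'a set \<Rightarrow> ('a \<Rightarrow> 'a \<Rightarrow> bool) \<Rightarrow> 'a set \<Rightarrow> 'a list \<Rightarrow> bool" where
  "is_A_path V E A p \<longleftrightarrow> is_path V E p \<and> length p \<ge> 2
     \<and> hd p \<in> A \<and> last p \<in> A
     \<and> (\<forall>i. 0 < i \<and> i < length p - 1 \<longrightarrow> p ! i \<notin> A)"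

definition is_even_A_path :: "'a set \<Rightarrow> ('a \<Rightarrow> 'a \<Rightarrow> bool) \<Rightarrow> 'a set \<Rightarrow> 'a list \<Rightarrow> bool" where
  "is_even_A_path V E A p \<longleftrightarrow> is_A_path V E A p \<and> even (length p - 1)"

end

theory Submission
  imports Defs
begin

text \<open>Take a forest in G of maximum degree 3 whose leaves are exactly its vertices in A, each of whose
components contains an even A-path, and which has as many leaves as possible. Let X consist of its
leaves and its vertices of degree 3. An even A-path avoiding X could either be added as a new
component or has an initial segment that can be attached to a vertex of degree 2, so X meets
every even A-path. A component with l leaves contributes 2l - 2 vertices to X. Cutting off, from the
bottom up, subtrees with three or four leaves (among three leaves, two are at even distance)
yields n disjoint even A-paths in it with l \<le> 4n + 2, hence 2l - 2 \<le> 8n + 2 \<le> 10n as n > 0.\<close>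

section \<open>Paths\<close>

lemma is_path_iff:
  "is_path V E p \<longleftrightarrow> p \<noteq> [] \<and> distinct p \<and> set p \<subseteq> V \<and> successively E p"
  by (auto simp: is_path_def successively_conv_nth)

lemma is_A_path_iff:
  "is_A_path V E A p \<longleftrightarrow> is_path V E p \<and> length p \<ge> 2 \<and> hd p \<in> A \<and> last p \<in> A
     \<and> set (butlast (tl p)) \<inter> A = {}"
proof -
  have "(\<forall>i. 0 < i \<and> i < length p - 1 \<longrightarrow> p ! i \<notin> A) \<longleftrightarrow> set (butlast (tl p)) \<inter> A = {}"
    (is "?L \<longleftrightarrow> ?R")
  proof
    assume L: ?L
    show ?R
    proof (rule ccontr)
      assume "\<not> ?R"
      then obtain i where i: "i < length (butlast (tl p))" "butlast (tl p) ! i \<in> A"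
        by (auto simp: in_set_conv_nth)
      then have "p ! Suc i \<in> A" by (simp add: nth_butlast nth_tl)
      with L i show False by auto
    qed
  next
    assume R: ?R
    show ?L
    proof (intro allI impI)
      fix i assume i: "0 < i \<and> i < length p - 1"
      then have "butlast (tl p) ! (i - 1) = p ! i"
        by (auto simp: nth_butlast nth_tl)
      moreover have "i - 1 < length (butlast (tl p))" using i by auto
      ultimately have "p ! i \<in> set (butlast (tl p))" by (metis nth_mem)
      then show "p ! i \<notin> A" using R by blast
    qed
  qed
  then show ?thesis by (simp add: is_A_path_def)
qed

text \<open>A partial \<open>A\<close>-path that grows at its head and meets \<open>A\<close> only
  in its last vertex. One-vertex paths are allowed, so that a single leaf carries one.\<close>

definition tail_path :: "'a set \<Rightarrow> ('a \<Rightarrow> 'a \<Rightarrow> bool) \<Rightarrow> 'a set \<Rightarrow> 'a list \<Rightarrow> bool" where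
  "tail_path V E A p \<longleftrightarrow> is_path V E p \<and> last p \<in> A \<and> set (butlast p) \<inter> A = {}"

lemma tail_path_singleton: "a \<in> A \<Longrightarrow> a \<in> V \<Longrightarrow> tail_path V E A [a]"
  by (simp add: tail_path_def is_path_iff)

lemma tail_path_Cons:
  assumes "tail_path V E A p" "E v (hd p)" "v \<notin> set p" "v \<in> V" "v \<notin> A"
  shows "tail_path V E A (v # p)"
  using assms by (auto simp: tail_path_def is_path_iff successively_Cons)

lemma A_path_Cons:
  assumes "tail_path V E A p" "E a (hd p)" "a \<notin> set p" "a \<in> V" "a \<in> A"
  shows "is_A_path V E A (a # p)"
  using assms by (cases p) (auto simp: tail_path_def is_A_path_iff is_path_iff successively_Cons)

text \<open>The joined path has \<open>length p + length q\<close> edges, so it is even exactly when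
  both lengths have the same parity.\<close>

lemma A_path_join:
  assumes p: "tail_path V E A p" "E v (hd p)" "v \<notin> set p"
    and q: "tail_path V E A q" "E v (hd q)" "v \<notin> set q"
    and v: "v \<in> V" "v \<notin> A" and "set p \<inter> set q = {}"
    and sym: "\<And>u w. E u w \<Longrightarrow> E w u"
  shows "is_A_path V E A (rev p @ v # q)"
proof -
  have ne: "p \<noteq> []" "q \<noteq> []" using p q by (auto simp: tail_path_def is_path_iff)
  have "successively E (rev p)"
    using p sym by (auto simp: tail_path_def is_path_iff intro: successively_mono)
  then have "is_path V E (rev p @ v # q)"
    using assms ne
    by (auto simp: tail_path_def is_path_iff successively_append_iff successively_Cons last_rev)
  moreover have "butlast (tl (rev p @ v # q)) = rev (butlast p) @ v # butlast q"
    using ne by (cases p rule: rev_cases) (simp_all add: butlast_append)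
  ultimately show ?thesis
    using assms ne by (auto simp: is_A_path_iff tail_path_def hd_rev Suc_le_eq)
qed

section \<open>Packings of disjoint even \<open>A\<close>-paths\<close>

text \<open>Recording the region \<open>W\<close> lets packings in disjoint regions be concatenated;
  \<open>sorted_wrt\<close> goes well with append and \<open>take\<close>.\<close>

definition packs :: "'a set \<Rightarrow> ('a \<Rightarrow> 'a \<Rightarrow> bool) \<Rightarrow> 'a set \<Rightarrow> 'a set \<Rightarrow> nat \<Rightarrow> bool" where
  "packs V E A W n \<longleftrightarrow> (\<exists>Ps. length Ps = n \<and> (\<forall>P\<in>set Ps. is_even_A_path V E A P \<and> set P \<subseteq> W)
     \<and> sorted_wrt (\<lambda>P Q. set P \<inter> set Q = {}) Ps)"

lemma packs_0: "packs V E A W 0"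
  by (simp add: packs_def)

lemma packs_1: "is_even_A_path V E A P \<Longrightarrow> set P \<subseteq> W \<Longrightarrow> packs V E A W 1"
  unfolding packs_def by (rule exI[of _ "[P]"]) simp

lemma packs_mono: "packs V E A W n \<Longrightarrow> W \<subseteq> W' \<Longrightarrow> packs V E A W' n"
  unfolding packs_def by blast

lemma packs_le:
  assumes "packs V E A W n" "k \<le> n"
  shows "packs V E A W k"
proof -
  obtain Ps where "length Ps = n" "\<forall>P\<in>set Ps. is_even_A_path V E A P \<and> set P \<subseteq> W"
    "sorted_wrt (\<lambda>P Q. set P \<inter> set Q = {}) Ps"
    using assms(1) unfolding packs_def by blast
  then show ?thesis
    using assms(2) unfolding packs_def
    by (intro exI[of _ "take k Ps"]) (auto simp: sorted_wrt_take dest: in_set_takeD)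
qed

lemma packs_Un:
  assumes "packs V E A W m" "packs V E A W' n" "W \<inter> W' = {}"
  shows "packs V E A (W \<union> W') (m + n)"
proof -
  obtain Ps Qs where
    "length Ps = m" "\<forall>P\<in>set Ps. is_even_A_path V E A P \<and> set P \<subseteq> W"
    "sorted_wrt (\<lambda>P Q. set P \<inter> set Q = {}) Ps"
    "length Qs = n" "\<forall>P\<in>set Qs. is_even_A_path V E A P \<and> set P \<subseteq> W'"
    "sorted_wrt (\<lambda>P Q. set P \<inter> set Q = {}) Qs"
    using assms(1,2) unfolding packs_def by blast
  with assms(3) show ?thesis
    unfolding packs_def by (intro exI[of _ "Ps @ Qs"]) (fastforce simp: sorted_wrt_append)
qed

section \<open>Trees of maximum degree 3\<close>

text \<open>Trees hang from an edge to a parent of \<open>top\<close>. With that edge counted, the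
  vertices of \<open>Leaf\<close>, \<open>Unary\<close> and \<open>Binary\<close> nodes have degree
  1, 2 and 3.\<close>

datatype 'a tree = Leaf 'a | Unary 'a "'a tree" | Binary 'a "'a tree" "'a tree"

fun top :: "'a tree \<Rightarrow> 'a" where
  "top (Leaf a) = a"
| "top (Unary v t) = v"
| "top (Binary v s t) = v"

fun leaves :: "'a tree \<Rightarrow> nat" where
  "leaves (Leaf a) = 1"
| "leaves (Unary v t) = leaves t"
| "leaves (Binary v s t) = leaves s + leaves t"

fun special :: "'a tree \<Rightarrow> 'a set" where
  "special (Leaf a) = {a}"
| "special (Unary v t) = special t"
| "special (Binary v s t) = insert v (special s \<union> special t)"

fun tree_in :: "'a set \<Rightarrow> ('a \<Rightarrow> 'a \<Rightarrow> bool) \<Rightarrow> 'a set \<Rightarrow> 'a tree \<Rightarrow> bool" where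
  "tree_in V E A (Leaf a) \<longleftrightarrow> a \<in> V \<and> a \<in> A"
| "tree_in V E A (Unary v t) \<longleftrightarrow> v \<in> V \<and> v \<notin> A \<and> v \<notin> set_tree t \<and> E v (top t) \<and> tree_in V E A t"
| "tree_in V E A (Binary v s t) \<longleftrightarrow> v \<in> V \<and> v \<notin> A \<and> v \<notin> set_tree s \<and> v \<notin> set_tree t
     \<and> set_tree s \<inter> set_tree t = {} \<and> E v (top s) \<and> E v (top t)
     \<and> tree_in V E A s \<and> tree_in V E A t"

lemma finite_set_tree: "finite (set_tree t)"
  by (induction t) auto

lemma special_subset: "special t \<subseteq> set_tree t"
  by (induction t) auto

lemma tree_in_subset: "tree_in V E A t \<Longrightarrow> set_tree t \<subseteq> V"
  by (induction t) auto

lemma tree_in_special: "tree_in V E A t \<Longrightarrow> set_tree t \<inter> A \<subseteq> special t"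
  by (induction t) auto

text \<open>A tree with l leaves has l - 1 binary nodes, which gives at most 2l - 1 special
  vertices.\<close>

lemma card_special: "Suc (card (special t)) \<le> 2 * leaves t"
proof (induction t)
  case (Binary v s t)
  have "card (special (Binary v s t)) \<le> Suc (card (special s \<union> special t))"
    by (simp add: card_insert_if finite_set_tree finite_subset[OF special_subset])
  also have "\<dots> \<le> Suc (card (special s) + card (special t))"
    by (simp add: card_Un_le)
  finally show ?case using Binary.IH by simp
qed auto

lemma leaves_le_card: "tree_in V E A t \<Longrightarrow> leaves t \<le> card (set_tree t)"
  by (induction t) (auto simp: finite_set_tree card_insert_if card_Un_disjoint)

lemma tree_of_tail_path:
  assumes "tail_path V E A p"
  shows "\<exists>t. tree_in V E A t \<and> top t = hd p \<and> set_tree t = set p \<and> leaves t = 1"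
  using assms
proof (induction p)
  case Nil
  then show ?case by (simp add: tail_path_def is_path_iff)
next
  case (Cons v p)
  show ?case
  proof (cases "p = []")
    case True
    with Cons.prems show ?thesis
      by (intro exI[of _ "Leaf v"]) (simp add: tail_path_def is_path_iff)
  next
    case False
    with Cons.prems have p: "tail_path V E A p"
      and v: "v \<in> V" "v \<notin> A" "v \<notin> set p" "E v (hd p)"
      by (auto simp: tail_path_def is_path_iff successively_Cons)
    from Cons.IH[OF p] obtain t where
      "tree_in V E A t" "top t = hd p" "set_tree t = set p" "leaves t = 1" by blast
    with v show ?thesis by (intro exI[of _ "Unary v t"]) simp
  qed
qed

text \<open>A vertex that is not special sits at a \<open>Unary\<close> node, so it can take the
  path \<open>q\<close> as a second child and become \<open>Binary\<close>. Keeping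
  \<open>top\<close> preserves the edge to the parent.\<close>

lemma graft:
  assumes "tree_in V E A t" "v \<in> set_tree t" "v \<notin> special t"
    and "tail_path V E A q" "E v (hd q)" "set q \<inter> set_tree t = {}"
  shows "\<exists>t'. tree_in V E A t' \<and> top t' = top t \<and> set_tree t' = set_tree t \<union> set q
    \<and> leaves t' = Suc (leaves t)"
  using assms
proof (induction t)
  case (Leaf a)
  then show ?case by simp
next
  case (Unary w t)
  show ?case
  proof (cases "w = v")
    case True
    obtain s where "tree_in V E A s" "top s = hd q" "set_tree s = set q" "leaves s = 1"
      using tree_of_tail_path[OF Unary.prems(4)] by blast
    with Unary.prems True show ?thesis by (intro exI[of _ "Binary v t s"]) auto
  next
    case False
    with Unary obtain t' where "tree_in V E A t'" "top t' = top t"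
      "set_tree t' = set_tree t \<union> set q" "leaves t' = Suc (leaves t)" by auto
    with Unary.prems show ?thesis by (intro exI[of _ "Unary w t'"]) auto
  qed
next
  case (Binary w s t)
  then have "w \<noteq> v" by auto
  with Binary.prems consider "v \<in> set_tree s" | "v \<in> set_tree t" by auto
  then show ?case
  proof cases
    case 1
    with Binary obtain s' where "tree_in V E A s'" "top s' = top s"
      "set_tree s' = set_tree s \<union> set q" "leaves s' = Suc (leaves s)" by auto
    with Binary.prems show ?thesis by (intro exI[of _ "Binary w s' t"]) auto
  next
    case 2
    with Binary obtain t' where "tree_in V E A t'" "top t' = top t"
      "set_tree t' = set_tree t \<union> set q" "leaves t' = Suc (leaves t)" by auto
    with Binary.prems show ?thesis by (intro exI[of _ "Binary w s t'"]) auto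
  qed
qed

section \<open>Packing even \<open>A\<close>-paths inside a tree\<close>

text \<open>\<open>U\<close> is the part used up by packed paths. The parity \<open>b\<close> refers
  to the number of vertices, which is the number of edges once the path is prolonged to a parent of
  the top.\<close>

definition free_path :: "'a set \<Rightarrow> ('a \<Rightarrow> 'a \<Rightarrow> bool) \<Rightarrow> 'a set \<Rightarrow> 'a tree \<Rightarrow> 'a set \<Rightarrow> bool \<Rightarrow> bool" where
  "free_path V E A t U b \<longleftrightarrow> (\<exists>p. tail_path V E A p \<and> hd p = top t \<and> set p \<subseteq> set_tree t - U
     \<and> even (length p) = b)"

lemma free_path_Cons:
  assumes "free_path V E A t U b" "E (top t') (top t)" "top t' \<in> V" "top t' \<notin> A"
    "top t' \<notin> set_tree t" "insert (top t') (set_tree t - U) \<subseteq> set_tree t' - U'"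
  shows "free_path V E A t' U' (\<not> b)"
proof -
  obtain p where p: "tail_path V E A p" "hd p = top t" "set p \<subseteq> set_tree t - U" "even (length p) = b"
    using assms(1) unfolding free_path_def by blast
  have "tail_path V E A (top t' # p)" using p assms by (intro tail_path_Cons) auto
  with p assms(6) show ?thesis
    unfolding free_path_def by (intro exI[of _ "top t' # p"]) auto
qed

text \<open>The leaves not accounted for by the n packed paths are those still reachable from the top. They
number at most 2, one for each parity in S: reaching the same parity through both children of a vertex
closes an even A-path through that vertex.\<close>

lemma tree_packing:
  assumes "tree_in V E A t" and sym: "\<And>u w. E u w \<Longrightarrow> E w u"
  shows "\<exists>U n S. U \<subseteq> set_tree t \<and> packs V E A U n \<and> (\<forall>b\<in>S. free_path V E A t U b)
    \<and> leaves t \<le> 4 * n + card S"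
  using assms(1)
proof (induction t)
  case (Leaf a)
  then have "free_path V E A (Leaf a) {} False"
    unfolding free_path_def by (intro exI[of _ "[a]"]) (simp add: tail_path_singleton)
  then show ?case
    by (intro exI[of _ "{}"] exI[of _ 0] exI[of _ "{False}"]) (simp add: packs_0)
next
  case (Unary v t)
  then obtain U n S where IH: "U \<subseteq> set_tree t" "packs V E A U n" "\<forall>b\<in>S. free_path V E A t U b"
    "leaves t \<le> 4 * n + card S" by auto
  \<comment> \<open>Prolonging a free path by \<open>v\<close> flips its parity, so distinct
    parities stay distinct.\<close>
  have "\<forall>b\<in>Not ` S. free_path V E A (Unary v t) U b"
  proof
    fix b assume "b \<in> Not ` S"
    then obtain c where c: "b = (\<not> c)" "c \<in> S" by blast
    then have "free_path V E A t U c" using IH(3) by blast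
    then show "free_path V E A (Unary v t) U b"
      unfolding c(1) by (rule free_path_Cons) (use IH(1) Unary.prems in auto)
  qed
  moreover have "card (Not ` S) = card S" by (rule card_image) (simp add: inj_on_def)
  ultimately show ?case
    using IH by (intro exI[of _ U] exI[of _ n] exI[of _ "Not ` S"]) auto
next
  case (Binary v s t)
  then obtain U n S where s: "U \<subseteq> set_tree s" "packs V E A U n" "\<forall>b\<in>S. free_path V E A s U b"
    "leaves s \<le> 4 * n + card S" by auto
  from Binary obtain U' n' S' where t: "U' \<subseteq> set_tree t" "packs V E A U' n'"
    "\<forall>b\<in>S'. free_path V E A t U' b" "leaves t \<le> 4 * n' + card S'" by auto
  have disj: "U \<inter> U' = {}" using s(1) t(1) Binary.prems by auto
  then have pack: "packs V E A (U \<union> U') (n + n')" by (rule packs_Un[OF s(2) t(2)])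
  show ?case
  proof (cases "S \<inter> S' = {}")
    case True
    \<comment> \<open>No parity occurs on both sides, so all survive and the two cardinalities add
      up.\<close>
    have "\<forall>b\<in>Not ` (S \<union> S'). free_path V E A (Binary v s t) (U \<union> U') b"
    proof
      fix b assume "b \<in> Not ` (S \<union> S')"
      then consider c where "b = (\<not> c)" "c \<in> S" | c where "b = (\<not> c)" "c \<in> S'" by blast
      then show "free_path V E A (Binary v s t) (U \<union> U') b"
      proof cases
        case 1
        then have "free_path V E A s U c" using s(3) by blast
        then show ?thesis
          unfolding 1(1) by (rule free_path_Cons) (use s(1) t(1) Binary.prems in auto)
      next
        case 2
        then have "free_path V E A t U' c" using t(3) by blast
        then show ?thesis
          unfolding 2(1) by (rule free_path_Cons) (use s(1) t(1) Binary.prems in auto)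
      qed
    qed
    moreover have "card (Not ` (S \<union> S')) = card S + card S'"
      using True by (subst card_image) (auto simp: inj_on_def card_Un_disjoint)
    ultimately show ?thesis
      using s t pack
      by (intro exI[of _ "U \<union> U'"] exI[of _ "n + n'"] exI[of _ "Not ` (S \<union> S')"]) auto
  next
    case False
    then obtain b where "free_path V E A s U b" "free_path V E A t U' b" using s(3) t(3) by blast
    then obtain p q where p: "tail_path V E A p" "hd p = top s" "set p \<subseteq> set_tree s - U"
      "even (length p) = b" and q: "tail_path V E A q" "hd q = top t" "set q \<subseteq> set_tree t - U'"
      "even (length q) = b"
      unfolding free_path_def by blast
    have "is_A_path V E A (rev p @ v # q)"
      by (rule A_path_join) (use p q Binary.prems sym in auto)
    then have even: "is_even_A_path V E A (rev p @ v # q)"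
      using p q by (auto simp: is_even_A_path_def)
    have "packs V E A ((U \<union> U') \<union> set (rev p @ v # q)) (n + n' + 1)"
    proof (rule packs_Un[OF pack packs_1[OF even]])
      show "(U \<union> U') \<inter> set (rev p @ v # q) = {}"
        using p(3) q(3) s(1) t(1) Binary.prems by auto
    qed simp
    then have "packs V E A (set_tree (Binary v s t)) (n + n' + 1)"
      by (rule packs_mono) (use p(3) q(3) s(1) t(1) in auto)
    \<comment> \<open>The one new path pays for all leaves still open, at most 2 + 2: this is the
      source of the factor 4.\<close>
    moreover have "card T \<le> 2" for T :: "bool set"
      using card_mono[of UNIV T] by (simp add: card_UNIV_bool)
    from this[of S] this[of S'] have "leaves (Binary v s t) \<le> 4 * (n + n' + 1)"
      using s(4) t(4) by simp
    \<comment> \<open>The new path runs through the top, so no free path is kept and the whole tree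
      counts as used.\<close>
    ultimately show ?thesis
      by (intro exI[of _ "set_tree (Binary v s t)"] exI[of _ "n + n' + 1"] exI[of _ "{}"]) simp
  qed
qed

section \<open>Forests\<close>

text \<open>A component is a tree together with a further leaf a, attached to the top of the tree.\<close>

fun verts :: "'a \<times> 'a tree \<Rightarrow> 'a set" where
  "verts (a, t) = insert a (set_tree t)"

fun hubs :: "'a \<times> 'a tree \<Rightarrow> 'a set" where
  "hubs (a, t) = insert a (special t)"

text \<open>The clause on \<open>P\<close> lets every component contribute a path: a lone
  \<open>A\<close>-path of odd length would have hubs but nothing to pack.\<close>

fun component :: "'a set \<Rightarrow> ('a \<Rightarrow> 'a \<Rightarrow> bool) \<Rightarrow> 'a set \<Rightarrow> 'a \<times> 'a tree \<Rightarrow> bool" where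
  "component V E A (a, t) \<longleftrightarrow> a \<in> V \<and> a \<in> A \<and> a \<notin> set_tree t \<and> E a (top t) \<and> tree_in V E A t
     \<and> (\<exists>P. is_even_A_path V E A P \<and> set P \<subseteq> verts (a, t))"

text \<open>With l = \<open>leaves t\<close>, there are at most 2l hubs, and m disjoint paths are
  found with l \<le> 4m + 1. Hence 2l \<le> 8m + 2 \<le> 10m if m > 0; if m = 0, the even path
  present in every component suffices.\<close>

lemma component_packing:
  assumes c: "component V E A c" and sym: "\<And>u w. E u w \<Longrightarrow> E w u"
  shows "\<exists>n. packs V E A (verts c) n \<and> card (hubs c) \<le> 10 * n"
proof -
  obtain a t where c_eq: "c = (a, t)" by (cases c)
  obtain P where P: "is_even_A_path V E A P" "set P \<subseteq> verts c" using c c_eq by auto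
  have a: "a \<in> V" "a \<in> A" "a \<notin> set_tree t" "E a (top t)" and t: "tree_in V E A t"
    using c c_eq by auto
  obtain U n S where U: "U \<subseteq> set_tree t" "packs V E A U n" "\<forall>b\<in>S. free_path V E A t U b"
    "leaves t \<le> 4 * n + card S"
    using tree_packing[OF t sym] by blast
  have "card (hubs c) \<le> Suc (card (special t))"
    by (simp add: c_eq card_insert_if finite_subset[OF special_subset finite_set_tree])
  with card_special[of t] have hubs: "card (hubs c) \<le> 2 * leaves t" by simp
  \<comment> \<open>Prefixing \<open>a\<close> to a free path with an even number of vertices gives
    an even \<open>A\<close>-path. If \<open>True\<close> is in \<open>S\<close>, this adds a path
    and 4n + 2 \<le> 4(n + 1) + 1; otherwise \<open>S\<close> has at most one element.\<close>
  have "\<exists>m. packs V E A (verts c) m \<and> leaves t \<le> 4 * m + 1"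
  proof (cases "True \<in> S")
    case True
    then have "free_path V E A t U True" using U(3) by blast
    then obtain p where p: "tail_path V E A p" "hd p = top t" "set p \<subseteq> set_tree t - U" "even (length p)"
      unfolding free_path_def by auto
    have "is_A_path V E A (a # p)"
      by (rule A_path_Cons) (use p a in auto)
    then have "is_even_A_path V E A (a # p)" using p by (simp add: is_even_A_path_def)
    then have "packs V E A (U \<union> set (a # p)) (n + 1)"
      by (intro packs_Un U(2) packs_1) (use U(1) p(3) a in auto)
    then have "packs V E A (verts c) (n + 1)"
      by (rule packs_mono) (use U(1) p(3) c_eq in auto)
    moreover have "card S \<le> 2" using card_mono[of UNIV S] by (simp add: card_UNIV_bool)
    ultimately show ?thesis using U(4) by (intro exI[of _ "n + 1"]) simp
  next
    case False
    then have "S \<subseteq> {False}" by (metis (full_types) insertI1 subsetI)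
    then have "card S \<le> 1" using card_mono[of "{False}" S] by simp
    moreover have "packs V E A (verts c) n"
      using U(2) by (rule packs_mono) (use U(1) c_eq in auto)
    ultimately show ?thesis using U(4) by (intro exI[of _ n]) simp
  qed
  then obtain m where m: "packs V E A (verts c) m" "leaves t \<le> 4 * m + 1" by blast
  show ?thesis
  proof (cases "m = 0")
    case True
    then show ?thesis using packs_1[OF P] m(2) hubs by (intro exI[of _ 1]) simp
  next
    case False
    then show ?thesis using m hubs by (intro exI[of _ m]) simp
  qed
qed

definition forest :: "'a set \<Rightarrow> ('a \<Rightarrow> 'a \<Rightarrow> bool) \<Rightarrow> 'a set \<Rightarrow> ('a \<times> 'a tree) list \<Rightarrow> bool" where
  "forest V E A cs \<longleftrightarrow> (\<forall>c\<in>set cs. component V E A c)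
     \<and> sorted_wrt (\<lambda>c d. verts c \<inter> verts d = {}) cs"

lemma finite_verts: "finite (verts c)"
  by (cases c) (simp add: finite_set_tree)

lemma component_verts: "component V E A c \<Longrightarrow> verts c \<subseteq> V"
  using tree_in_subset by (cases c) fastforce

lemma component_hubs: "component V E A c \<Longrightarrow> verts c \<inter> A \<subseteq> hubs c"
  using tree_in_special by (cases c) fastforce

lemma hubs_subset: "hubs c \<subseteq> verts c"
  using special_subset by (cases c) fastforce

lemma forest_packing:
  assumes "forest V E A cs" and sym: "\<And>u w. E u w \<Longrightarrow> E w u"
  shows "\<exists>n. packs V E A (\<Union>c\<in>set cs. verts c) n \<and> card (\<Union>c\<in>set cs. hubs c) \<le> 10 * n"
  using assms(1)
proof (induction cs)
  case Nil
  then show ?case by (intro exI[of _ 0]) (simp add: packs_0)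
next
  case (Cons c cs)
  then obtain n where n: "packs V E A (\<Union>c\<in>set cs. verts c) n" "card (\<Union>c\<in>set cs. hubs c) \<le> 10 * n"
    by (auto simp: forest_def)
  have "component V E A c" using Cons.prems by (simp add: forest_def)
  from component_packing[OF this sym] obtain m where
    m: "packs V E A (verts c) m" "card (hubs c) \<le> 10 * m" by blast
  have "packs V E A (verts c \<union> (\<Union>c\<in>set cs. verts c)) (m + n)"
    by (rule packs_Un[OF m(1) n(1)]) (use Cons.prems in \<open>auto simp: forest_def\<close>)
  moreover have "card (hubs c \<union> (\<Union>c\<in>set cs. hubs c)) \<le> 10 * (m + n)"
    using card_Un_le[of "hubs c" "\<Union>c\<in>set cs. hubs c"] m(2) n(2) by simp
  ultimately show ?case by auto
qed

text \<open>Leaves are distinct vertices and components are disjoint. This bound makes a forest with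
  the most leaves exist.\<close>

lemma forest_leaves_le:
  assumes "forest V E A cs"
  shows "(\<Sum>(a, t)\<leftarrow>cs. leaves t) \<le> card (\<Union>c\<in>set cs. verts c)"
  using assms
proof (induction cs)
  case (Cons c cs)
  obtain a t where c: "c = (a, t)" by (cases c)
  have t: "tree_in V E A t" using Cons.prems c by (simp add: forest_def)
  have "leaves t \<le> card (verts c)"
    using leaves_le_card[OF t] by (simp add: c card_insert_if finite_set_tree)
  moreover have "(\<Sum>(a, t)\<leftarrow>cs. leaves t) \<le> card (\<Union>c\<in>set cs. verts c)"
    using Cons by (simp add: forest_def)
  moreover have "card (verts c \<union> (\<Union>c\<in>set cs. verts c)) = card (verts c) + card (\<Union>c\<in>set cs. verts c)"
    using Cons.prems by (intro card_Un_disjoint) (auto simp: forest_def finite_verts)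
  ultimately show ?case using c by simp
qed simp

section \<open>Enlarging a forest along a path that avoids its hubs\<close>

lemma forest_extend:
  assumes cs: "forest V E A cs" and P: "is_even_A_path V E A P"
    and avoid: "(\<Union>c\<in>set cs. hubs c) \<inter> set P = {}"
    and sym: "\<And>u w. E u w \<Longrightarrow> E w u"
  shows "\<exists>cs'. forest V E A cs' \<and> (\<Sum>(a, t)\<leftarrow>cs. leaves t) < (\<Sum>(a, t)\<leftarrow>cs'. leaves t)"
proof -
  have path: "is_path V E P" "length P \<ge> 2" "hd P \<in> A" "last P \<in> A" "set (butlast (tl P)) \<inter> A = {}"
    using P by (auto simp: is_even_A_path_def is_A_path_iff)
  show ?thesis
  proof (cases "set P \<inter> (\<Union>c\<in>set cs. verts c) = {}")
    case True
    obtain a p where ap: "P = a # p" "p \<noteq> []" using path(2) by (cases P) (auto simp: Suc_le_eq)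
    have "tail_path V E A p"
      using path ap by (auto simp: tail_path_def is_path_iff successively_Cons)
    from tree_of_tail_path[OF this] obtain t where
      t: "tree_in V E A t" "top t = hd p" "set_tree t = set p" "leaves t = 1" by blast
    \<comment> \<open>The first vertex of \<open>P\<close> serves as the extra leaf, the rest as a
      chain below it, and \<open>P\<close> itself is the required even path.\<close>
    have "component V E A (a, t)"
      using t path ap P by (auto simp: is_path_iff successively_Cons)
    moreover have "verts (a, t) \<inter> verts c = {}" if "c \<in> set cs" for c
      using True that t(3) ap(1) by auto
    ultimately have "forest V E A ((a, t) # cs)"
      using cs by (auto simp: forest_def)
    with t(4) show ?thesis by (intro exI[of _ "(a, t) # cs"]) simp
  next
    case False
    \<comment> \<open>Taking \<open>v\<close> as the first vertex of \<open>P\<close> in the forest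
      keeps \<open>ys\<close> outside every component, so attaching it preserves
      disjointness.\<close>
    then obtain ys v zs where ys: "P = ys @ v # zs" "v \<in> (\<Union>c\<in>set cs. verts c)"
      "\<forall>y\<in>set ys. y \<notin> (\<Union>c\<in>set cs. verts c)"
      using split_list_first_prop[of P "\<lambda>v. v \<in> (\<Union>c\<in>set cs. verts c)"] by blast
    from ys(2) obtain a t where at: "(a, t) \<in> set cs" "v \<in> verts (a, t)" by auto
    have comp: "component V E A (a, t)" using cs at(1) unfolding forest_def by blast
    have v: "v \<notin> hubs (a, t)" using avoid at(1) ys(1) by auto
    then have "v \<notin> A" using component_hubs[OF comp] at(2) by auto
    \<comment> \<open>\<open>P\<close> starts in \<open>A\<close> while \<open>v\<close> lies
      outside \<open>A\<close>, so \<open>v\<close> is not its first vertex.\<close>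
    then have ne: "ys \<noteq> []" using path(3) ys(1) by auto
    have "tail_path V E A (rev ys)"
    proof -
      have "successively E (rev ys)"
        using path(1) ys(1) sym
        by (auto simp: is_path_iff successively_append_iff intro: successively_mono)
      \<comment> \<open>Since \<open>v\<close> comes later, all of \<open>ys\<close> but its head is
        interior to \<open>P\<close>; so \<open>rev ys\<close> meets \<open>A\<close> only in its
        last vertex.\<close>
      moreover have "set (tl ys) \<subseteq> set (butlast (tl P))"
        using ys(1) ne by (cases ys) (auto simp: butlast_append)
      ultimately show ?thesis
        using path ys(1) ne
        by (auto simp: tail_path_def is_path_iff last_rev butlast_rev)
    qed
    moreover have "E v (hd (rev ys))"
      using path(1) ys(1) ne sym by (auto simp: is_path_iff successively_append_iff hd_rev)
    moreover have "set (rev ys) \<inter> set_tree t = {}" using ys(3) at(1) by fastforce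
    ultimately obtain t' where t': "tree_in V E A t'" "top t' = top t"
      "set_tree t' = set_tree t \<union> set (rev ys)" "leaves t' = Suc (leaves t)"
      using graft[of V E A t v "rev ys"] comp at(2) v by auto
    have "a \<notin> set ys" using ys(3) at(1) by fastforce
    \<comment> \<open>The old even path still lies in the enlarged vertex set.\<close>
    then have comp': "component V E A (a, t')" using comp t' by auto
    obtain xs zs' where split: "cs = xs @ (a, t) # zs'" using at(1) split_list by fastforce
    have grown: "verts (a, t') = verts (a, t) \<union> set ys" using t'(3) by simp
    have ys_disj: "set ys \<inter> verts c = {}" "verts c \<inter> set ys = {}" if "c \<in> set xs \<union> set zs'" for c
      using ys(3) that by (auto simp: split)
    have "forest V E A (xs @ (a, t') # zs')"
      using cs comp' grown ys_disj
      by (simp add: split forest_def sorted_wrt_append Int_Un_distrib Int_Un_distrib2)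
    with t'(4) show ?thesis by (intro exI[of _ "xs @ (a, t') # zs'"]) (simp add: split)
  qed
qed

section \<open>Choosing a forest with the most leaves\<close>

theorem theorem7:
  fixes V :: "'a set" and E :: "'a \<Rightarrow> 'a \<Rightarrow> bool" and A :: "'a set" and k :: nat
  assumes "k \<ge> 1" and "finite_graph V E" and "A \<subseteq> V"
  shows "(\<exists>Ps :: 'a list list. length Ps = k
            \<and> (\<forall>P \<in> set Ps. is_even_A_path V E A P)
            \<and> (\<forall>i j. i < k \<and> j < k \<and> i \<noteq> j \<longrightarrow> set (Ps ! i) \<inter> set (Ps ! j) = {}))
       \<or> (\<exists>X. X \<subseteq> V \<and> card X \<le> 10 * k
            \<and> (\<forall>P. is_even_A_path V E A P \<longrightarrow> X \<inter> set P \<noteq> {}))"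
proof -
  have fin: "finite V" and sym: "\<And>u w. E u w \<Longrightarrow> E w u"
    using assms(2) by (auto simp: finite_graph_def)
  have verts: "(\<Union>c\<in>set cs. verts c) \<subseteq> V" if "forest V E A cs" for cs
    by (intro UN_least component_verts[where E = E and A = A])
      (use that in \<open>auto simp: forest_def\<close>)
  \<comment> \<open>The extra leaf of each component is left out of the count; both a new component
    and a graft still raise it by 1.\<close>
  let ?l = "\<lambda>cs. \<Sum>(a, t)\<leftarrow>cs. leaves t"
  have "?l cs \<le> card V" if "forest V E A cs" for cs
    using forest_leaves_le[OF that] card_mono[OF fin verts[OF that]] by (rule le_trans)
  moreover have "forest V E A []" by (simp add: forest_def)
  ultimately have "\<exists>cs. forest V E A cs \<and> (\<forall>cs'. forest V E A cs' \<longrightarrow> ?l cs' \<le> ?l cs)"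
    by (intro ex_has_greatest_nat[where k = "[]" and b = "Suc (card V)"]) (auto simp: less_Suc_eq_le)
  then obtain cs where cs: "forest V E A cs"
    and max: "\<And>cs'. forest V E A cs' \<Longrightarrow> ?l cs' \<le> ?l cs"
    by blast
  let ?X = "\<Union>c\<in>set cs. hubs c"
  obtain n where n: "packs V E A (\<Union>c\<in>set cs. verts c) n" "card ?X \<le> 10 * n"
    using forest_packing[OF cs sym] by blast
  show ?thesis
  \<comment> \<open>Either k of the n packed paths are taken, or n < k and the at most 10n hubs form
    the hitting set.\<close>
  proof (cases "k \<le> n")
    case True
    then obtain Ps where Ps: "length Ps = k" "\<forall>P\<in>set Ps. is_even_A_path V E A P"
      "sorted_wrt (\<lambda>P Q. set P \<inter> set Q = {}) Ps"
      using packs_le[OF n(1) True] unfolding packs_def by blast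
    have "set (Ps ! i) \<inter> set (Ps ! j) = {}" if "i < k" "j < k" "i \<noteq> j" for i j
      using that Ps(1,3) by (cases i j rule: linorder_cases) (auto simp: sorted_wrt_iff_nth_less)
    with Ps show ?thesis by blast
  next
    case False
    have "?X \<subseteq> V" using verts[OF cs] hubs_subset by fast
    moreover have "card ?X \<le> 10 * k" using n(2) False by simp
    \<comment> \<open>A path avoiding all hubs would yield a forest with more leaves, against
      maximality.\<close>
    moreover have "?X \<inter> set P \<noteq> {}" if "is_even_A_path V E A P" for P
      using forest_extend[OF cs that _ sym] max by (meson not_less)
    ultimately show ?thesis by blast
  qed
qed

end
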